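(* Let $m,n$ be positive integers, let $X\subseteq\mathbb{R}^n$ be a nonempty closed convex set with $0\in X$ and let $\mathcal{A}\in\mathbb{T}_{m,n}$. For any $q\in\mathbb{R}^n$, if the function $F(x):=\mathcal{A}x^{m-1}+q$ is strictly monotone on $X$, then VI$(X,F)$ has a unique solution.
   Context: $\mathbb{T}_{m,n}$ denotes the set of all $m$-order $n$-dimensional real tensors $\mathcal{A}=(a_{i_1i_2\cdots i_m})$, with $i_1,\ldots,i_m\in[n]:=\{1,\ldots,n\}$. For $x\in\mathbb{R}^n$, $\mathcal{A}x^{m-1}\in\mathbb{R}^n$ is the vector with components $(\mathcal{A}x^{m-1})_i=\sum_{i_2,\ldots,i_m=1}^n a_{ii_2\cdots i_m}x_{i_2}\cdots x_{i_m}$. A mapping $F:X\subseteq\mathbb{R}^n\to\mathbb{R}^n$ is strictly monotone on $X$ if $\langle F(x)-F(y),x-y\rangle>0$ for all $x,y\in X$ with $x\neq y$ (for $F(x)=\mathcal{A}x^{m-1}+q$ this condition does not depend on $q$). VI$(X,F)$ is the problem of finding $x^*\in X$ such that $\langle y-x^*,F(x^* )\rangle\ge 0$ for all $y\in X$. *)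

theory Defs
  imports "HOL-Analysis.Analysis"
begin

text \<open>A tensor of order \<open>m\<close> and dimension \<open>n = CARD('n)\<close> is a family of reals indexed by
  the lists \<open>[i\<^sub>1, \<dots>, i\<^sub>m]\<close> over \<open>'n\<close>; extensionality makes it determined by those entries.\<close>

definition tensors :: "nat \<Rightarrow> ('n::finite list \<Rightarrow> real) set" where
  "tensors m = {js. length js = m} \<rightarrow>\<^sub>E UNIV"

text \<open>The vector \<open>A x\<^sup>m\<^sup>-\<^sup>1\<close>. The list \<open>js\<close> is \<open>[i\<^sub>2, \<dots>, i\<^sub>m]\<close>; it is empty for \<open>m = 1\<close>, where
  the result is the constant vector \<open>A\<close>. Only meaningful for \<open>m \<ge> 1\<close>.\<close>

definition tensor_apply ::
  "nat \<Rightarrow> ('n::finite list \<Rightarrow> real) \<Rightarrow> real ^ 'n \<Rightarrow> real ^ 'n" where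
  "tensor_apply m A x =
     (\<chi> i. \<Sum>js | length js = m - 1. A (i # js) * (\<Prod>j\<leftarrow>js. x $ j))"

definition strictly_monotone_on :: "'a::real_inner set \<Rightarrow> ('a \<Rightarrow> 'a) \<Rightarrow> bool" where
  "strictly_monotone_on X F \<longleftrightarrow>
     (\<forall>x\<in>X. \<forall>y\<in>X. x \<noteq> y \<longrightarrow> (F x - F y) \<bullet> (x - y) > 0)"

definition VI_solution :: "'a::real_inner set \<Rightarrow> ('a \<Rightarrow> 'a) \<Rightarrow> 'a \<Rightarrow> bool" where
  "VI_solution X F x \<longleftrightarrow> x \<in> X \<and> (\<forall>y\<in>X. (y - x) \<bullet> F x \<ge> 0)"

end

theory Submission
  imports Defs
begin

text \<open>For \<open>m = 1\<close> strict monotonicity forces \<open>X = {0}\<close>. For \<open>m \<ge> 2\<close> the map \<open>G x = A x\<^sup>m\<^sup>-\<^sup>1\<close> is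
  homogeneous of degree \<open>m - 1 \<ge> 1\<close> and vanishes at \<open>0 \<in> X\<close>, so strict monotonicity gives
  \<open>x \<bullet> G x > 0\<close> on \<open>X - {0}\<close>. By compactness \<open>x \<bullet> G x \<ge> c > 0\<close> on the unit sphere of \<open>X\<close>, and
  by homogeneity \<open>x \<bullet> (G x + q) > 0\<close> on the part of \<open>X\<close> of norm \<open>r\<close>, for \<open>r\<close> large. Hence the
  solution on \<open>X \<inter> cball 0 r\<close> provided by Brouwer's theorem has norm less than \<open>r\<close>, and such a
  solution solves the problem on all of \<open>X\<close>.\<close>

text \<open>Testing each solution against the other and adding the two inequalities gives
  \<open>(F x - F y) \<bullet> (x - y) \<le> 0\<close>.\<close>

lemma VI_solution_unique:
  assumes "strictly_monotone_on X F" "VI_solution X F x" "VI_solution X F y"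
  shows "x = y"
proof (rule ccontr)
  assume "x \<noteq> y"
  then have "(F x - F y) \<bullet> (x - y) > 0"
    using assms unfolding strictly_monotone_on_def VI_solution_def by blast
  moreover have "(y - x) \<bullet> F x \<ge> 0" "(x - y) \<bullet> F y \<ge> 0"
    using assms unfolding VI_solution_def by blast+
  ultimately show False
    by (simp add: inner_diff_left inner_diff_right inner_commute)
qed

text \<open>Solutions are the fixed points of \<open>x \<mapsto> P\<^sub>X (x - F x)\<close>, with \<open>P\<^sub>X\<close> the projection onto \<open>X\<close>.\<close>

lemma VI_solution_compact:
  fixes X :: "'a::euclidean_space set"
  assumes "compact X" "convex X" "X \<noteq> {}" "continuous_on X F"
  obtains x where "VI_solution X F x"
proof -
  let ?f = "\<lambda>x. closest_point X (x - F x)"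
  have "closed X"
    using assms(1) by (rule compact_imp_closed)
  have "continuous_on UNIV (closest_point X)"
    using assms(2) \<open>closed X\<close> assms(3) by (rule continuous_on_closest_point)
  then have "continuous_on X ?f"
    by (rule continuous_on_compose2) (intro continuous_on_diff continuous_on_id assms(4) subset_UNIV)+
  moreover have "?f \<in> X \<rightarrow> X"
    using closest_point_in_set \<open>closed X\<close> assms(3) by blast
  ultimately obtain x where x: "x \<in> X" "?f x = x"
    using brouwer[OF assms(1-3)] by blast
  \<comment> \<open>The projection \<open>x\<close> of \<open>x - F x\<close> makes an obtuse angle:
    \<open>((x - F x) - x) \<bullet> (y - x) \<le> 0\<close>.\<close>
  have "(y - x) \<bullet> F x \<ge> 0" if "y \<in> X" for y
    using closest_point_dot[OF assms(2) \<open>closed X\<close> that, of "x - F x"] x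
    by (simp add: inner_commute)
  with x(1) show ?thesis
    using that by (auto simp: VI_solution_def)
qed

text \<open>Since \<open>x\<close> lies strictly inside the ball, a short step from \<open>x\<close>
  towards any \<open>y\<close> in \<open>X\<close> stays in the truncated set; the inequality there
  is a positive multiple of the one for \<open>y\<close>.\<close>

lemma VI_solution_Int_cball:
  assumes "convex X" and sol: "VI_solution (X \<inter> cball 0 r) F x" and "norm x < r"
  shows "VI_solution X F x"
  unfolding VI_solution_def
proof (intro conjI ballI)
  show "x \<in> X"
    using sol by (simp add: VI_solution_def)
  fix y assume "y \<in> X"
  \<comment> \<open>Chosen so that \<open>norm x + t * norm (y - x) \<le> r\<close>; the
    \<open>+ 1\<close> keeps the denominator positive when \<open>y = x\<close>.\<close>
  define t where "t = min 1 ((r - norm x) / (norm (y - x) + 1))"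
  have t: "0 < t" "t \<le> 1"
    using assms(3) by (auto simp: t_def intro!: divide_pos_pos add_nonneg_pos)
  have "t \<le> (r - norm x) / (norm (y - x) + 1)"
    by (simp add: t_def)
  then have "t * (norm (y - x) + 1) \<le> r - norm x"
    by (simp add: pos_le_divide_eq add_nonneg_pos)
  then have "norm (x + t *\<^sub>R (y - x)) \<le> r"
    using norm_triangle_ineq[of x "t *\<^sub>R (y - x)"] t by (simp add: distrib_left)
  moreover have "x + t *\<^sub>R (y - x) \<in> X"
    using convexD_alt[OF assms(1) \<open>x \<in> X\<close> \<open>y \<in> X\<close>, of t] t by (simp add: algebra_simps)
  ultimately have "x + t *\<^sub>R (y - x) \<in> X \<inter> cball 0 r"
    by simp
  then have "(x + t *\<^sub>R (y - x) - x) \<bullet> F x \<ge> 0"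
    using sol unfolding VI_solution_def by blast
  then show "(y - x) \<bullet> F x \<ge> 0"
    using t by (simp add: zero_le_mult_iff)
qed

lemma VI_solution_exists_if_pos_on_sphere:
  fixes X :: "'a::euclidean_space set"
  assumes "closed X" "convex X" "0 \<in> X" "continuous_on X F" "0 \<le> r"
    and pos: "\<And>x. x \<in> X \<Longrightarrow> norm x = r \<Longrightarrow> x \<bullet> F x > 0"
  obtains x where "VI_solution X F x"
proof -
  obtain x where x: "VI_solution (X \<inter> cball 0 r) F x"
  proof (rule VI_solution_compact)
    show "compact (X \<inter> cball 0 r)"
      using assms(1) by (simp add: closed_Int_compact)
    show "convex (X \<inter> cball 0 r)"
      using assms(2) by (simp add: convex_Int)
    show "X \<inter> cball 0 r \<noteq> {}"
      using assms(3,5) by auto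
    show "continuous_on (X \<inter> cball 0 r) F"
      using assms(4) by (rule continuous_on_subset) simp
  qed
  \<comment> \<open>Testing the truncated problem at \<open>y = 0\<close> gives
    \<open>x \<bullet> F x \<le> 0\<close>, which \<open>pos\<close> excludes on the sphere of
    radius \<open>r\<close>.\<close>
  then have "x \<in> X" "norm x \<le> r" "x \<bullet> F x \<le> 0"
    using assms(3,5) unfolding VI_solution_def by force+
  with pos have "norm x < r"
    by force
  with x show ?thesis
    using VI_solution_Int_cball[OF assms(2)] that by blast
qed

lemma prod_list_map_mult_const:
  fixes f :: "'b \<Rightarrow> 'a::comm_monoid_mult"
  shows "(\<Prod>j\<leftarrow>js. c * f j) = c ^ length js * (\<Prod>j\<leftarrow>js. f j)"
  by (induction js) (simp_all add: ac_simps)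

lemma continuous_on_prod_list:
  fixes f :: "'b \<Rightarrow> 'c::topological_space \<Rightarrow> 'a::{monoid_mult, topological_semigroup_mult}"
  assumes "\<And>j. j \<in> set js \<Longrightarrow> continuous_on S (f j)"
  shows "continuous_on S (\<lambda>x. \<Prod>j\<leftarrow>js. f j x)"
  using assms by (induction js) (simp_all add: continuous_on_mult')

lemma tensor_apply_scaleR:
  "tensor_apply m A (c *\<^sub>R x) = c ^ (m - 1) *\<^sub>R tensor_apply m A x"
  by (simp add: tensor_apply_def vec_eq_iff prod_list_map_mult_const sum_distrib_left
      mult.left_commute)

lemma continuous_on_tensor_apply: "continuous_on S (tensor_apply m A)"
  unfolding tensor_apply_def
  by (intro continuous_on_vec_lambda continuous_on_sum continuous_on_mult continuous_on_const
      continuous_on_prod_list continuous_on_component continuous_on_id)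

lemma tensor_apply_1: "tensor_apply 1 A x = tensor_apply 1 A y"
  by (simp add: tensor_apply_def)

text \<open>This is homogeneity with factor 0. The degree must be positive: for \<open>m = 1\<close>
  the empty product is 1 and the map is constant.\<close>

lemma tensor_apply_0:
  assumes "m \<ge> 2"
  shows "tensor_apply m A 0 = 0"
  using tensor_apply_scaleR[of m A 0 0] assms by (simp add: power_0_left)

lemma inner_tensor_apply_coercive:
  fixes X :: "(real ^ 'n::finite) set"
  assumes "closed X" "convex X" "0 \<in> X" "m \<ge> 2"
    and mono: "strictly_monotone_on X (\<lambda>x. tensor_apply m A x + q)"
  obtains r where "r > 0"
    and "\<And>x. x \<in> X \<Longrightarrow> norm x = r \<Longrightarrow> x \<bullet> (tensor_apply m A x + q) > 0"
proof -
  let ?G = "tensor_apply m A"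
  have G_pos: "x \<bullet> ?G x > 0" if "x \<in> X" "x \<noteq> 0" for x
  proof -
    have "(?G x + q - (?G 0 + q)) \<bullet> (x - 0) > 0"
      using mono that \<open>0 \<in> X\<close> unfolding strictly_monotone_on_def by blast
    then show ?thesis
      by (simp add: tensor_apply_0 \<open>m \<ge> 2\<close> inner_commute)
  qed
  obtain c where "c > 0" and c: "\<And>u. u \<in> X \<inter> sphere 0 1 \<Longrightarrow> c \<le> u \<bullet> ?G u"
  \<comment> \<open>A minimum is attained only on a nonempty set; in the empty case any positive
    \<open>c\<close> will do.\<close>
  proof (cases "X \<inter> sphere 0 1 = {}")
    case True
    then show ?thesis
      using that[of 1] by auto
  next
    case False
    have "compact (X \<inter> sphere 0 1)"
      using assms(1) by (simp add: closed_Int_compact)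
    moreover have "continuous_on (X \<inter> sphere 0 1) (\<lambda>u. u \<bullet> ?G u)"
      by (intro continuous_intros continuous_on_tensor_apply)
    ultimately obtain v where "v \<in> X \<inter> sphere 0 1"
      and "\<forall>u\<in>X \<inter> sphere 0 1. v \<bullet> ?G v \<le> u \<bullet> ?G u"
      using continuous_attains_inf[OF _ False] by blast
    moreover from this have "v \<bullet> ?G v > 0"
      by (intro G_pos) auto
    ultimately show ?thesis
      using that by blast
  qed
  \<comment> \<open>This gives \<open>r * c = norm q + c > norm q\<close>, and
    \<open>r \<ge> 1\<close> allows passing from \<open>r\<close> to
    \<open>r ^ (m - 1)\<close>.\<close>
  define r where "r = norm q / c + 1"
  have "r \<ge> 1"
    using \<open>c > 0\<close> by (simp add: r_def)
  have "norm q < r * c"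
    using \<open>c > 0\<close> by (simp add: r_def field_simps)
  also have "\<dots> \<le> r ^ (m - 1) * c"
    using \<open>r \<ge> 1\<close> \<open>c > 0\<close> \<open>m \<ge> 2\<close> self_le_power[of r "m - 1"] by simp
  finally have r: "norm q < r ^ (m - 1) * c" .
  have "x \<bullet> (?G x + q) > 0" if "x \<in> X" "norm x = r" for x
  proof -
    define u where "u = (1 / r) *\<^sub>R x"
    have x: "x = r *\<^sub>R u"
      using \<open>r \<ge> 1\<close> by (simp add: u_def)
    \<comment> \<open>\<open>X\<close> need not be a cone, but shrinking is allowed: as
      \<open>1 / r \<le> 1\<close>, \<open>u\<close> is a convex combination of \<open>0\<close> and
      \<open>x\<close>.\<close>
    have "u \<in> X"
      using convexD_alt[OF assms(2,3) \<open>x \<in> X\<close>, of "1 / r"] \<open>r \<ge> 1\<close> by (simp add: u_def)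
    moreover have "norm u = 1"
      using that \<open>r \<ge> 1\<close> by (simp add: u_def)
    ultimately have "r ^ (m - 1) * c \<le> r ^ (m - 1) * (u \<bullet> ?G u)"
      using c \<open>r \<ge> 1\<close> by (simp add: mult_left_mono)
    moreover have "- norm q \<le> u \<bullet> q"
      using Cauchy_Schwarz_ineq2[of u q] \<open>norm u = 1\<close> by simp
    ultimately have "0 < r ^ (m - 1) * (u \<bullet> ?G u) + u \<bullet> q"
      using r by linarith
    then have "0 < r * (r ^ (m - 1) * (u \<bullet> ?G u) + u \<bullet> q)"
      using \<open>r \<ge> 1\<close> by simp
    then show ?thesis
      unfolding x tensor_apply_scaleR by (simp add: inner_add_right distrib_left mult.left_commute)
  qed
  with \<open>r \<ge> 1\<close> show ?thesis
    using that[of r] by simp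
qed

theorem corollary4p2:
  fixes m :: nat and X :: "(real ^ 'n::finite) set"
    and A :: "'n list \<Rightarrow> real" and q :: "real ^ 'n"
  assumes "m \<ge> 1"
    and "X \<noteq> {}" and "closed X" and "convex X" and "0 \<in> X"
    and "A \<in> tensors m"
    and "strictly_monotone_on X (\<lambda>x. tensor_apply m A x + q)"
  shows "\<exists>!x. VI_solution X (\<lambda>x. tensor_apply m A x + q) x"
proof -
  let ?F = "\<lambda>x. tensor_apply m A x + q"
  obtain x where "VI_solution X ?F x"
  proof (cases "m = 1")
    case True
    \<comment> \<open>The map is constant here, so monotonicity between \<open>y\<close> and 0 would
      read \<open>0 > 0\<close> if \<open>y\<close> were nonzero.\<close>
    have "y = 0" if "y \<in> X" for y
    proof (rule ccontr)
      assume "y \<noteq> 0"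
      then have "(?F y - ?F 0) \<bullet> (y - 0) > 0"
        using assms(5,7) that unfolding strictly_monotone_on_def by blast
      then show False
        using tensor_apply_1[of A y 0] by (simp add: True)
    qed
    then have "VI_solution X ?F 0"
      using assms(5) by (force simp: VI_solution_def)
    then show ?thesis
      by (rule that)
  next
    case False
    then have "m \<ge> 2"
      using assms(1) by simp
    then obtain r where "r > 0" "\<And>x. x \<in> X \<Longrightarrow> norm x = r \<Longrightarrow> x \<bullet> ?F x > 0"
      using inner_tensor_apply_coercive[OF assms(3-5) _ assms(7)] by blast
    moreover have "continuous_on X ?F"
      by (intro continuous_intros continuous_on_tensor_apply)
    ultimately show ?thesis
      using VI_solution_exists_if_pos_on_sphere[OF assms(3-5), of ?F r] that by (meson less_imp_le)
  qed
  then show ?thesis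
    using VI_solution_unique[OF assms(7)] by blast
qed

end
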